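(* Let $G=(V^+,V^-;E)$ be a bipartite graph with $|V^+|<|V^-|$. Then \[\mathrm{opt}(G)=\max_{\mathcal X^+}\tau_G(\mathcal X^+),\] where the maximum is taken over all subpartitions $\mathcal X^+$ of $V^+$ (including the empty one), and \[\tau_G(\mathcal X^+):=\sum_{X\in\mathcal X^+}\bigl(|X|-|\Gamma_G(X)|+1\bigr).\]
   Context: A bipartite graph $G=(V^+,V^-;E)$ has finite disjoint vertex sides $V^+,V^-$, and its edge set satisfies $E\subseteq V^+\times V^-$ (no parallel edges). For $X\subseteq V^+$, $\Gamma_G(X)\subseteq V^-$ is the set of vertices adjacent to some vertex of $X$. DM-decomposition. Define $f_G(X)=|\Gamma_G(X)|-|X|$ for $X\subseteq V^+$. Its minimizers form a lattice $\mathcal L$ closed under union and intersection. Take a maximal chain $X_0\subsetneq\cdots\subsetneq X_k$ in $\mathcal L$ and set: - $V_0=X_0\cup\Gamma_G(X_0)$; - $V_i=(X_i\setminus X_{i-1})\cup(\Gamma_G(X_i)\setminus\Gamma_G(X_{i-1}))$ for $i=1,\dots,k$; - $V_\infty=(V^+\setminus X_k)\cup(V^-\setminus\Gamma_G(X_k))$. This partition of $V=V^+\cup V^-$ is independent of the chain chosen. $G$ is DM-irreducible if exactly one part is nonempty, i.e. $V_0=V$, or $V_1=V$, or $V_\infty=V$. For $F\subseteq V^+\times V^-$, $G+F=(V^+,V^-;E\cup F)$. $\mathrm{opt}(G)$ is the minimum of $|F|$ over $F\subseteq(V^+\times V^-)\setminus E$ such that $G+F$ is DM-irreducible. A subpartition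 of a set $S$ is a family of pairwise disjoint nonempty subsets of $S$. *)

theory Defs
  imports Main "HOL-Library.Disjoint_Sets"
begin

definition bipartite_graph :: "'a set \<Rightarrow> 'a set \<Rightarrow> ('a \<times> 'a) set \<Rightarrow> bool" where
  "bipartite_graph Vp Vm E \<longleftrightarrow>
     finite Vp \<and> finite Vm \<and> Vp \<inter> Vm = {} \<and> E \<subseteq> Vp \<times> Vm"

abbreviation neighbours :: "('a \<times> 'a) set \<Rightarrow> 'a set \<Rightarrow> 'a set" ("\<Gamma>") where
  "\<Gamma> E X \<equiv> E `` X"

definition surplus :: "('a \<times> 'a) set \<Rightarrow> 'a set \<Rightarrow> int" where
  "surplus E X = int (card (\<Gamma> E X)) - int (card X)"

definition minimizer_lattice :: "'a set \<Rightarrow> ('a \<times> 'a) set \<Rightarrow> 'a set set" where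
  "minimizer_lattice Vp E = {X. is_arg_min (surplus E) (\<lambda>Y. Y \<subseteq> Vp) X}"

text \<open>The list is \<open>[X\<^sub>0, \<dots>, X\<^sub>k]\<close>, so \<open>k\<close> is its length minus one.\<close>

definition dm_chain :: "'a set \<Rightarrow> ('a \<times> 'a) set \<Rightarrow> 'a set list \<Rightarrow> bool" where
  "dm_chain Vp E Xs \<longleftrightarrow>
     sorted_wrt (\<subset>) Xs \<and> subset.maxchain (minimizer_lattice Vp E) (set Xs)"

text \<open>The list is \<open>[V\<^sub>0, V\<^sub>1, \<dots>, V\<^sub>k, V\<^sub>\<infinity>]\<close>; its first and last
  entries may be empty.\<close>

definition dm_parts ::
  "'a set \<Rightarrow> 'a set \<Rightarrow> ('a \<times> 'a) set \<Rightarrow> 'a set list \<Rightarrow> 'a set list" where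
  "dm_parts Vp Vm E Xs =
     [hd Xs \<union> \<Gamma> E (hd Xs)]
     @ map (\<lambda>i. (Xs ! i - Xs ! (i - 1)) \<union> (\<Gamma> E (Xs ! i) - \<Gamma> E (Xs ! (i - 1))))
         [1..<length Xs]
     @ [(Vp - last Xs) \<union> (Vm - \<Gamma> E (last Xs))]"

text \<open>The partition does not depend on the maximal chain, and for a finite graph a
  maximal chain always exists, so quantifying existentially over the chain is harmless.\<close>

definition dm_irreducible :: "'a set \<Rightarrow> 'a set \<Rightarrow> ('a \<times> 'a) set \<Rightarrow> bool" where
  "dm_irreducible Vp Vm E \<longleftrightarrow>
     (\<exists>Xs. dm_chain Vp E Xs \<and>
        (\<exists>!i. i < length (dm_parts Vp Vm E Xs) \<and> dm_parts Vp Vm E Xs ! i \<noteq> {}))"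

definition dm_opt :: "'a set \<Rightarrow> 'a set \<Rightarrow> ('a \<times> 'a) set \<Rightarrow> nat" where
  "dm_opt Vp Vm E =
     Min {card F | F. F \<subseteq> (Vp \<times> Vm) - E \<and> dm_irreducible Vp Vm (E \<union> F)}"

definition subpartition_of :: "'a set set \<Rightarrow> 'a set \<Rightarrow> bool" where
  "subpartition_of \<X> S \<longleftrightarrow> (\<forall>X\<in>\<X>. X \<noteq> {} \<and> X \<subseteq> S) \<and> disjoint \<X>"

definition tau :: "('a \<times> 'a) set \<Rightarrow> 'a set set \<Rightarrow> int" where
  "tau E \<X> = (\<Sum>X\<in>\<X>. int (card X) - int (card (\<Gamma> E X)) + 1)"

end

theory Submission
  imports Defs
begin

text \<open>
  Since \<open>|V\<^sup>+| < |V\<^sup>-|\<close>, irreducibility means that \<open>\<emptyset>\<close> is the only minimizer of the surplus.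
  The deficiency \<open>p X = |X| - |\<Gamma> X| + 1\<close> is supermodular; hence so is
  \<open>T S\<close>, the maximum of \<open>\<Sum>\<^sub>X p X\<close> over the subpartitions of \<open>S\<close>, by uncrossing.
  If \<open>T V\<^sup>+ > 0\<close>, then the sets \<open>S\<close> with \<open>T S = T V\<^sup>+\<close> are closed under intersection, so some
  vertex \<open>u\<close> is covered by every optimal subpartition. The sets \<open>X\<close> with
  \<open>p X + T (V\<^sup>+ - X) = T V\<^sup>+\<close>, which are the blocks of optimal subpartitions, are closed under
  union when they share \<open>u\<close>, so there is a largest one. It has a non-neighbour \<open>w\<close>, since
  otherwise its deficiency would be at most \<open>0\<close> and it could be dropped. Adding the edge
  \<open>(u, w)\<close> lowers the value of every optimal subpartition by one.
\<close>

section \<open>Maximum weight of a subpartition\<close>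

text \<open>The inequality is required for disjoint pairs too, where \<open>p {}\<close> enters; for
  the deficiency below that value is 1.\<close>

definition supermodular :: "('a set \<Rightarrow> int) \<Rightarrow> 'a set \<Rightarrow> bool" where
  "supermodular p V \<longleftrightarrow> (\<forall>X\<subseteq>V. \<forall>Y\<subseteq>V. p X + p Y \<le> p (X \<union> Y) + p (X \<inter> Y))"

lemma supermodularD:
  "supermodular p V \<Longrightarrow> X \<subseteq> V \<Longrightarrow> Y \<subseteq> V \<Longrightarrow> p X + p Y \<le> p (X \<union> Y) + p (X \<inter> Y)"
  by (auto simp: supermodular_def)

text \<open>Blocks are nonempty, so \<open>p {}\<close> never counts, and the empty family makes the
  value nonnegative.\<close>

definition max_weight :: "('a set \<Rightarrow> int) \<Rightarrow> 'a set \<Rightarrow> int" where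
  "max_weight p S = Max {sum p \<X> | \<X>. subpartition_of \<X> S}"

section \<open>Elementary properties of subpartitions\<close>

lemma subpartition_of_empty [simp]: "subpartition_of {} S"
  by (simp add: subpartition_of_def)

lemma subpartition_of_mono: "subpartition_of \<X> S \<Longrightarrow> S \<subseteq> T \<Longrightarrow> subpartition_of \<X> T"
  by (auto simp: subpartition_of_def)

lemma subpartition_of_subset: "subpartition_of \<X> S \<Longrightarrow> \<Y> \<subseteq> \<X> \<Longrightarrow> subpartition_of \<Y> S"
  by (auto simp: subpartition_of_def intro: pairwise_subset)

lemma subpartition_of_Union: "subpartition_of \<X> S \<Longrightarrow> subpartition_of \<X> (\<Union>\<X>)"
  by (auto simp: subpartition_of_def)

lemma Union_subpartition_of: "subpartition_of \<X> S \<Longrightarrow> \<Union>\<X> \<subseteq> S"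
  by (auto simp: subpartition_of_def)

lemma subpartition_of_disjoint:
  "subpartition_of \<X> S \<Longrightarrow> X \<in> \<X> \<Longrightarrow> Y \<in> \<X> \<Longrightarrow> X \<noteq> Y \<Longrightarrow> X \<inter> Y = {}"
  by (auto simp: subpartition_of_def disjoint_def)

lemma subpartition_of_Un:
  assumes "subpartition_of \<X> S" "subpartition_of \<Y> T" "S \<inter> T = {}"
  shows "subpartition_of (\<X> \<union> \<Y>) (S \<union> T)"
proof -
  have "\<Union>\<X> \<inter> \<Union>\<Y> = {}"
    using Union_subpartition_of[OF assms(1)] Union_subpartition_of[OF assms(2)] assms(3) by blast
  then have "disjoint (\<X> \<union> \<Y>)"
    using assms(1,2) by (intro disjoint_union) (simp_all add: subpartition_of_def)
  then show ?thesis
    using assms(1,2) by (auto simp: subpartition_of_def)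
qed

lemma subpartition_of_insert:
  assumes "subpartition_of \<X> (S - X)" "X \<noteq> {}" "X \<subseteq> S"
  shows "subpartition_of (insert X \<X>) S"
proof -
  have "subpartition_of {X} X"
    using assms by (auto simp: subpartition_of_def)
  from subpartition_of_Un[OF assms(1) this] show ?thesis
    using assms(3) by (simp add: Int_commute Un_absorb2)
qed

lemma subpartition_of_remove:
  assumes "subpartition_of \<X> S" "X \<in> \<X>"
  shows "subpartition_of (\<X> - {X}) (S - X)"
proof -
  have "Y \<subseteq> S - X" if "Y \<in> \<X> - {X}" for Y
    using subpartition_of_disjoint[OF assms(1), of Y X] assms that
    by (auto simp: subpartition_of_def)
  then show ?thesis
    using subpartition_of_subset[OF assms(1), of "\<X> - {X}"] by (auto simp: subpartition_of_def)
qed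

lemma finite_subpartitions: "finite S \<Longrightarrow> finite {\<X>. subpartition_of \<X> S}"
  by (rule finite_subset[of _ "Pow (Pow S)"]) (auto simp: subpartition_of_def)

lemma finite_subpartition_of: "finite S \<Longrightarrow> subpartition_of \<X> S \<Longrightarrow> finite \<X>"
  by (rule finite_subset[of _ "Pow S"]) (auto simp: subpartition_of_def)

lemma finite_subpartition_sums: "finite S \<Longrightarrow> finite {sum p \<X> | \<X>. subpartition_of \<X> S}"
  by (simp add: setcompr_eq_image finite_subpartitions)

section \<open>Maximum weight and optimal blocks\<close>

lemma max_weight_ge: "finite S \<Longrightarrow> subpartition_of \<X> S \<Longrightarrow> sum p \<X> \<le> max_weight p S"
  unfolding max_weight_def by (rule Max_ge[OF finite_subpartition_sums]) auto

lemma max_weight_attained: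
  assumes "finite S"
  obtains \<X> where "subpartition_of \<X> S" "sum p \<X> = max_weight p S"
proof -
  have "max_weight p S \<in> {sum p \<X> | \<X>. subpartition_of \<X> S}"
    unfolding max_weight_def
    by (rule Max_in[OF finite_subpartition_sums[OF assms]]) (use subpartition_of_empty in blast)
  then show thesis
    using that by auto
qed

lemma max_weight_mono:
  assumes "finite T" "S \<subseteq> T"
  shows "max_weight p S \<le> max_weight p T"
proof -
  obtain \<X> where "subpartition_of \<X> S" "sum p \<X> = max_weight p S"
    using max_weight_attained[OF finite_subset[OF assms(2,1)]] by metis
  then show ?thesis
    using max_weight_ge[OF assms(1), of \<X> p] subpartition_of_mono[OF _ assms(2)] by simp
qed

lemma max_weight_empty: "max_weight p {} = 0"
proof -
  have "\<X> = {}" if "subpartition_of \<X> {}" for \<X> :: "'a set set"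
    using that by (auto simp: subpartition_of_def)
  then show ?thesis
    by (metis finite.emptyI max_weight_attained sum.empty)
qed

text \<open>Adjoining \<open>X\<close> to an optimal subpartition of \<open>V - X\<close> gives a
  competitor on \<open>V\<close>. The equality case later serves to describe the blocks of optimal
  subpartitions.\<close>

lemma weight_add_max_weight_Diff_le:
  assumes "finite V" "X \<subseteq> V" "X \<noteq> {}"
  shows "p X + max_weight p (V - X) \<le> max_weight p V"
proof -
  obtain \<X> where \<X>: "subpartition_of \<X> (V - X)" "sum p \<X> = max_weight p (V - X)"
    using max_weight_attained assms(1) by (metis finite_Diff)
  have "X \<notin> \<X>"
    using \<X>(1) assms(3) by (auto simp: subpartition_of_def)
  moreover have "finite \<X>"
    using finite_subpartition_of \<X>(1) assms(1) by blast
  ultimately show ?thesis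
    using max_weight_ge[OF assms(1) subpartition_of_insert[OF \<X>(1) assms(3,2)], of p] \<X>(2) by simp
qed

text \<open>Removing the block leaves a subpartition of \<open>V - X\<close>, which gives the
  inequality opposite to the preceding lemma.\<close>

lemma optimal_block:
  assumes "finite V" "subpartition_of \<X> V" "sum p \<X> = max_weight p V" "X \<in> \<X>"
  shows "p X + max_weight p (V - X) = max_weight p V"
proof (rule antisym)
  show "p X + max_weight p (V - X) \<le> max_weight p V"
    using assms by (intro weight_add_max_weight_Diff_le) (auto simp: subpartition_of_def)
  have "sum p \<X> = p X + sum p (\<X> - {X})"
    using finite_subpartition_of[OF assms(1,2)] assms(4) by (rule sum.remove)
  also have "\<dots> \<le> p X + max_weight p (V - X)"
    using max_weight_ge[OF _ subpartition_of_remove[OF assms(2,4)]] assms(1) by simp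
  finally show "max_weight p V \<le> p X + max_weight p (V - X)"
    using assms(3) by simp
qed

section \<open>Uncrossing subpartitions\<close>

text \<open>The members of \<open>\<U>\<close> are absorbed into \<open>X\<close> one at a time. By
  disjointness each meets the set merged so far only inside \<open>X\<close>, so the intersection
  term is exactly \<open>p (U \<inter> X)\<close>.\<close>

lemma supermodular_merge:
  assumes sm: "supermodular p V"
    and "finite \<U>" "disjoint \<U>" "\<Union>\<U> \<subseteq> V" "X \<subseteq> V"
  shows "p X + sum p \<U> \<le> p (X \<union> \<Union>\<U>) + (\<Sum>U\<in>\<U>. p (U \<inter> X))"
  using assms(2-)
proof (induction \<U>)
  case (insert U \<U>)
  have "(X \<union> \<Union>\<U>) \<inter> U = U \<inter> X"
    using insert.prems(1) insert.hyps(2) by (auto simp: disjoint_def)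
  then have "p (X \<union> \<Union>\<U>) + p U \<le> p (X \<union> \<Union>\<U> \<union> U) + p (U \<inter> X)"
    using supermodularD[OF sm, of "X \<union> \<Union>\<U>" U] insert.prems by auto
  moreover have "p X + sum p \<U> \<le> p (X \<union> \<Union>\<U>) + (\<Sum>U\<in>\<U>. p (U \<inter> X))"
    using insert.prems by (intro insert.IH) (auto simp: disjoint_def)
  moreover have "X \<union> \<Union>\<U> \<union> U = X \<union> \<Union>(insert U \<U>)"
    by auto
  ultimately show ?case
    using insert.hyps by simp
qed simp

text \<open>Induction on the blocks of \<open>\<X>\<close>: a new block \<open>X\<close> is fused
  with all members of \<open>\<U>\<close> that it meets, and the traces of those members on
  \<open>X\<close> are moved to \<open>\<W>\<close>.\<close>

lemma subpartitions_uncross: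
  assumes sm: "supermodular p V" and fin: "finite V"
    and "subpartition_of \<X> V" and \<Y>: "subpartition_of \<Y> V"
  shows "\<exists>\<U> \<W>. subpartition_of \<U> (\<Union>\<X> \<union> \<Union>\<Y>) \<and> subpartition_of \<W> (\<Union>\<X> \<inter> \<Union>\<Y>) \<and>
           sum p \<X> + sum p \<Y> \<le> sum p \<U> + sum p \<W>"
  using finite_subpartition_of[OF fin assms(3)] assms(3)
proof (induction \<X>)
  case empty
  show ?case
    using subpartition_of_Union[OF \<Y>] by (intro exI[of _ \<Y>] exI[of _ "{}"]) auto
next
  case (insert X \<X>)
  define S where "S = \<Union>\<X> \<union> \<Union>\<Y>"
  have X: "X \<noteq> {}" "X \<subseteq> V" and \<X>: "subpartition_of \<X> V"
    using insert.prems by (auto simp: subpartition_of_def pairwise_insert)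
  have dX: "X \<inter> \<Union>\<X> = {}"
    using subpartition_of_disjoint[OF insert.prems, of X] insert.hyps(2) by blast
  have "S \<subseteq> V"
    using Union_subpartition_of[OF \<X>] Union_subpartition_of[OF \<Y>] by (simp add: S_def)
  obtain \<U> \<W> where \<U>: "subpartition_of \<U> S" and \<W>: "subpartition_of \<W> (\<Union>\<X> \<inter> \<Union>\<Y>)"
    and le: "sum p \<X> + sum p \<Y> \<le> sum p \<U> + sum p \<W>"
    using insert.IH[OF \<X>] unfolding S_def by blast
  \<comment> \<open>Only members meeting \<open>X\<close> are taken, so that every trace is nonempty
    and can serve as a block.\<close>
  define \<M> where "\<M> = {U\<in>\<U>. U \<inter> X \<noteq> {}}"
  define M where "M = X \<union> \<Union>\<M>"
  have \<M>: "subpartition_of \<M> S" and "\<M> \<subseteq> \<U>"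
    using subpartition_of_subset[OF \<U>] by (auto simp: \<M>_def)
  have fin\<U>: "finite \<U>" and fin\<M>: "finite \<M>"
    using finite_subpartition_of \<U> \<M> finite_subset[OF \<open>S \<subseteq> V\<close> fin] by blast+
  have fin\<W>: "finite \<W>"
    using finite_subset[OF \<open>S \<subseteq> V\<close> fin] by (intro finite_subpartition_of[OF _ \<W>]) (auto simp: S_def)

  have "\<Union>(\<U> - \<M>) \<inter> M = {}"
    using subpartition_of_disjoint[OF \<U>] by (fastforce simp: M_def \<M>_def)
  moreover have "\<Union>(\<U> - \<M>) \<subseteq> S"
    using Union_subpartition_of[OF \<U>] by blast
  moreover have "subpartition_of (\<U> - \<M>) (\<Union>(\<U> - \<M>))"
    using subpartition_of_Union subpartition_of_subset[OF \<U>] by blast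
  ultimately have "subpartition_of (\<U> - \<M>) ((X \<union> S) - M)"
    by (elim subpartition_of_mono) blast
  then have \<U>': "subpartition_of (insert M (\<U> - \<M>)) (X \<union> S)"
    using X(1) Union_subpartition_of[OF \<M>] by (intro subpartition_of_insert) (auto simp: M_def)
  have "M \<notin> \<U> - \<M>"
    using X(1) by (auto simp: M_def \<M>_def)
  then have sum\<U>': "sum p (insert M (\<U> - \<M>)) = p M + sum p (\<U> - \<M>)"
    using fin\<U> by simp

  \<comment> \<open>Traces of distinct members are disjoint and nonempty, hence distinct, so no
    summand is lost in passing to the image.\<close>
  have inj: "inj_on (\<lambda>U. U \<inter> X) \<M>"
    using subpartition_of_disjoint[OF \<U>] by (fastforce simp: inj_on_def \<M>_def)
  \<comment> \<open>A trace lies in \<open>\<Union>\<Y>\<close> because its member lies in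
    \<open>S\<close> and \<open>X\<close> misses the earlier blocks of \<open>\<X>\<close>.\<close>
  have "subpartition_of ((\<lambda>U. U \<inter> X) ` \<M>) (X \<inter> \<Union>\<Y>)"
    using subpartition_of_disjoint[OF \<U>] Union_subpartition_of[OF \<U>] dX
    unfolding subpartition_of_def disjoint_def S_def \<M>_def by blast
  from subpartition_of_Un[OF \<W> this]
  have \<W>': "subpartition_of (\<W> \<union> (\<lambda>U. U \<inter> X) ` \<M>) (\<Union>(insert X \<X>) \<inter> \<Union>\<Y>)"
    using Union_subpartition_of[OF \<X>] dX by - (rule subpartition_of_mono, auto)
  have "\<W> \<inter> (\<lambda>U. U \<inter> X) ` \<M> = {}"
    using Union_subpartition_of[OF \<W>] dX by (fastforce simp: \<M>_def)
  then have sum\<W>': "sum p (\<W> \<union> (\<lambda>U. U \<inter> X) ` \<M>) = sum p \<W> + (\<Sum>U\<in>\<M>. p (U \<inter> X))"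
    using fin\<M> fin\<W> by (simp add: sum.union_disjoint sum.reindex[OF inj])

  have "p X + sum p \<M> \<le> p M + (\<Sum>U\<in>\<M>. p (U \<inter> X))"
    unfolding M_def
    using fin\<M> \<M> X \<open>S \<subseteq> V\<close> Union_subpartition_of[OF \<M>]
    by (intro supermodular_merge[OF sm]) (auto simp: subpartition_of_def)
  moreover have "sum p \<U> = sum p (\<U> - \<M>) + sum p \<M>"
    using fin\<U> \<open>\<M> \<subseteq> \<U>\<close> by (metis sum.subset_diff)
  ultimately have "sum p (insert X \<X>) + sum p \<Y>
      \<le> sum p (insert M (\<U> - \<M>)) + sum p (\<W> \<union> (\<lambda>U. U \<inter> X) ` \<M>)"
    unfolding sum\<U>' sum\<W>' using le insert.hyps by simp
  moreover have "X \<union> S = \<Union>(insert X \<X>) \<union> \<Union>\<Y>"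
    by (auto simp: S_def)
  ultimately show ?case
    using \<U>' \<W>' by metis
qed

text \<open>Uncross optimal subpartitions of \<open>A\<close> and \<open>B\<close>: the two
  resulting families compete on \<open>A \<union> B\<close> and \<open>A \<inter> B\<close>.\<close>

lemma supermodular_max_weight:
  assumes sm: "supermodular p V" and fin: "finite V"
  shows "supermodular (max_weight p) V"
  unfolding supermodular_def
proof (intro allI impI)
  fix A B assume AB: "A \<subseteq> V" "B \<subseteq> V"
  have finAB: "finite A" "finite B"
    using AB fin finite_subset by auto
  obtain \<X> \<Y> where \<X>: "subpartition_of \<X> A" "sum p \<X> = max_weight p A"
    and \<Y>: "subpartition_of \<Y> B" "sum p \<Y> = max_weight p B"
    using max_weight_attained finAB by metis
  obtain \<U> \<W> where \<U>: "subpartition_of \<U> (\<Union>\<X> \<union> \<Union>\<Y>)" and \<W>: "subpartition_of \<W> (\<Union>\<X> \<inter> \<Union>\<Y>)"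
    and le: "sum p \<X> + sum p \<Y> \<le> sum p \<U> + sum p \<W>"
    using subpartitions_uncross[OF sm fin subpartition_of_mono[OF \<X>(1) AB(1)]
        subpartition_of_mono[OF \<Y>(1) AB(2)]] by blast
  have sub: "\<Union>\<X> \<subseteq> A" "\<Union>\<Y> \<subseteq> B"
    using \<X>(1) \<Y>(1) by (auto dest: Union_subpartition_of)
  have "subpartition_of \<U> (A \<union> B)"
    by (rule subpartition_of_mono[OF \<U>]) (use sub in blast)
  moreover have "subpartition_of \<W> (A \<inter> B)"
    by (rule subpartition_of_mono[OF \<W>]) (use sub in blast)
  ultimately show "max_weight p A + max_weight p B \<le> max_weight p (A \<union> B) + max_weight p (A \<inter> B)"
    using max_weight_ge[of "A \<union> B" \<U> p] max_weight_ge[of "A \<inter> B" \<W> p] finAB le \<X>(2) \<Y>(2)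
    by simp
qed

section \<open>Vertices and blocks shared by optimal subpartitions\<close>

text \<open>Monotonicity bounds both terms on the right of the supermodular inequality by the
  maximum, so closure under intersection follows. A minimal optimal set is then the least one, and
  it is nonempty because the empty set has maximum weight 0.\<close>

lemma common_point_of_optimal:
  assumes sm: "supermodular p V" and fin: "finite V" and pos: "max_weight p V > 0"
  obtains u where "u \<in> V"
    and "\<And>S. S \<subseteq> V \<Longrightarrow> max_weight p S = max_weight p V \<Longrightarrow> u \<in> S"
proof -
  define \<O> where "\<O> = {S. S \<subseteq> V \<and> max_weight p S = max_weight p V}"
  have Int: "A \<inter> B \<in> \<O>" if "A \<in> \<O>" "B \<in> \<O>" for A B
  proof -
    have AB: "A \<subseteq> V" "B \<subseteq> V" "max_weight p A = max_weight p V" "max_weight p B = max_weight p V"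
      using that by (auto simp: \<O>_def)
    have "max_weight p (A \<union> B) \<le> max_weight p V" "max_weight p (A \<inter> B) \<le> max_weight p V"
      using AB fin by (auto intro!: max_weight_mono)
    moreover have "max_weight p A + max_weight p B \<le> max_weight p (A \<union> B) + max_weight p (A \<inter> B)"
      using supermodularD[OF supermodular_max_weight[OF sm fin] AB(1,2)] .
    ultimately show ?thesis
      using AB by (auto simp: \<O>_def)
  qed
  have "finite \<O>"
    using fin by (auto simp: \<O>_def intro: finite_subset[of _ "Pow V"])
  moreover have "V \<in> \<O>"
    by (simp add: \<O>_def)
  ultimately obtain A where A: "A \<in> \<O>" and min: "\<And>B. B \<in> \<O> \<Longrightarrow> B \<subseteq> A \<Longrightarrow> B = A"
    using finite_has_minimal[of \<O>] by (metis empty_iff)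
  have "A \<noteq> {}"
    using A pos max_weight_empty[of p] by (auto simp: \<O>_def)
  then obtain u where "u \<in> A"
    by blast
  show thesis
  proof (rule that)
    show "u \<in> V"
      using \<open>u \<in> A\<close> A by (auto simp: \<O>_def)
    show "u \<in> S" if "S \<subseteq> V" "max_weight p S = max_weight p V" for S
    proof -
      have "S \<in> \<O>"
        using that by (simp add: \<O>_def)
      then have "A \<inter> S = A"
        by (rule min[OF Int[OF A]]) simp
      then show ?thesis
        using \<open>u \<in> A\<close> by blast
    qed
  qed
qed

text \<open>Both \<open>p\<close> and \<open>max_weight p\<close> are supermodular, and
  complementation swaps union and intersection. Adding the two inequalities forces equality for the
  union, so a maximal member of the family is the largest.\<close>

lemma largest_optimal_block:
  assumes sm: "supermodular p V" and fin: "finite V" and "u \<in> V"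
    and u: "\<And>S. S \<subseteq> V \<Longrightarrow> max_weight p S = max_weight p V \<Longrightarrow> u \<in> S"
  obtains M where "M \<subseteq> V" "u \<in> M" "p M + max_weight p (V - M) = max_weight p V"
    and "\<And>X. X \<subseteq> V \<Longrightarrow> u \<in> X \<Longrightarrow> p X + max_weight p (V - X) = max_weight p V \<Longrightarrow> X \<subseteq> M"
proof -
  define \<B> where "\<B> = {X. X \<subseteq> V \<and> u \<in> X \<and> p X + max_weight p (V - X) = max_weight p V}"
  have Un: "X \<union> Y \<in> \<B>" if "X \<in> \<B>" "Y \<in> \<B>" for X Y
  proof -
    have XY: "X \<subseteq> V" "Y \<subseteq> V" "u \<in> X" "u \<in> Y"
      "p X + max_weight p (V - X) = max_weight p V" "p Y + max_weight p (V - Y) = max_weight p V"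
      using that by (auto simp: \<B>_def)
    have "p X + p Y \<le> p (X \<union> Y) + p (X \<inter> Y)"
      using supermodularD[OF sm XY(1,2)] .
    moreover have "max_weight p (V - X) + max_weight p (V - Y)
        \<le> max_weight p (V - (X \<inter> Y)) + max_weight p (V - (X \<union> Y))"
      using supermodularD[OF supermodular_max_weight[OF sm fin], of "V - X" "V - Y"]
      by (simp add: Diff_Un Diff_Int)
    \<comment> \<open>The common vertex \<open>u\<close> keeps \<open>X \<inter> Y\<close> nonempty,
      as the bound demands.\<close>
    moreover have "p (X \<union> Y) + max_weight p (V - (X \<union> Y)) \<le> max_weight p V"
      "p (X \<inter> Y) + max_weight p (V - (X \<inter> Y)) \<le> max_weight p V"
      using XY(1-4) by (auto intro!: weight_add_max_weight_Diff_le[OF fin])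
    ultimately show ?thesis
      using XY by (auto simp: \<B>_def)
  qed
  \<comment> \<open>The family is inhabited: the union of an optimal subpartition has full weight,
    so it contains \<open>u\<close>, and the block covering \<open>u\<close> belongs to
    \<open>\<B>\<close>.\<close>
  obtain \<X> where \<X>: "subpartition_of \<X> V" "sum p \<X> = max_weight p V"
    using max_weight_attained[OF fin] by metis
  have sub: "\<Union>\<X> \<subseteq> V"
    by (rule Union_subpartition_of[OF \<X>(1)])
  then have "max_weight p (\<Union>\<X>) = max_weight p V"
    using max_weight_ge[OF _ subpartition_of_Union[OF \<X>(1)], of p] \<X>(2) max_weight_mono[OF fin sub, of p]
      finite_subset[OF sub fin] by simp
  then obtain X where "X \<in> \<X>" "u \<in> X"
    using u[OF sub] by blast
  then have "X \<in> \<B>"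
    using optimal_block[OF fin \<X>] sub by (auto simp: \<B>_def)
  moreover have "finite \<B>"
    using fin by (auto simp: \<B>_def intro: finite_subset[of _ "Pow V"])
  ultimately obtain M where M: "M \<in> \<B>" and max: "\<And>B. B \<in> \<B> \<Longrightarrow> M \<subseteq> B \<Longrightarrow> B = M"
    using finite_has_maximal[of \<B>] by (metis empty_iff)
  have "X \<subseteq> M" if "X \<in> \<B>" for X
    using max[OF Un[OF M that]] by blast
  then show thesis
    using M by (intro that[of M]) (auto simp: \<B>_def)
qed

section \<open>Deficiency and edge addition\<close>

text \<open>The \<open>+ 1\<close> turns a nonpositive value into the strict Hall inequality
  \<open>card X < card (\<Gamma> E X)\<close>.\<close>

definition deficiency :: "('a \<times> 'a) set \<Rightarrow> 'a set \<Rightarrow> int" where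
  "deficiency E X = int (card X) - int (card (\<Gamma> E X)) + 1"

lemma tau_eq_sum_deficiency: "tau E \<X> = sum (deficiency E) \<X>"
  by (simp add: tau_def deficiency_def)

lemma bipartite_graphD:
  assumes "bipartite_graph Vp Vm E"
  shows "finite Vp" "finite Vm" "E \<subseteq> Vp \<times> Vm" "\<Gamma> E X \<subseteq> Vm" "finite (\<Gamma> E X)"
proof -
  show *: "finite Vp" "finite Vm" "E \<subseteq> Vp \<times> Vm" "\<Gamma> E X \<subseteq> Vm"
    using assms by (auto simp: bipartite_graph_def)
  show "finite (\<Gamma> E X)"
    using *(2,4) finite_subset by blast
qed

lemma bipartite_graph_Un:
  "bipartite_graph Vp Vm E \<Longrightarrow> F \<subseteq> Vp \<times> Vm \<Longrightarrow> bipartite_graph Vp Vm (E \<union> F)"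
  by (auto simp: bipartite_graph_def)

text \<open>Cardinality is modular and neighbourhoods commute with unions, while
  \<open>\<Gamma> E (X \<inter> Y)\<close> is merely contained in
  \<open>\<Gamma> E X \<inter> \<Gamma> E Y\<close>.\<close>

lemma supermodular_deficiency:
  assumes "bipartite_graph Vp Vm E"
  shows "supermodular (deficiency E) Vp"
  unfolding supermodular_def
proof (intro allI impI)
  fix X Y assume "X \<subseteq> Vp" "Y \<subseteq> Vp"
  then have "finite X" "finite Y"
    using bipartite_graphD(1)[OF assms] finite_subset by auto
  then have "card X + card Y = card (X \<union> Y) + card (X \<inter> Y)"
    by (rule card_Un_Int)
  moreover have "card (\<Gamma> E X) + card (\<Gamma> E Y) = card (\<Gamma> E (X \<union> Y)) + card (\<Gamma> E X \<inter> \<Gamma> E Y)"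
    using card_Un_Int[of "\<Gamma> E X" "\<Gamma> E Y"] bipartite_graphD(5)[OF assms] by (simp add: Image_Un)
  moreover have "card (\<Gamma> E (X \<inter> Y)) \<le> card (\<Gamma> E X \<inter> \<Gamma> E Y)"
    using bipartite_graphD(5)[OF assms] by (intro card_mono) auto
  ultimately show "deficiency E X + deficiency E Y
      \<le> deficiency E (X \<union> Y) + deficiency E (X \<inter> Y)"
    by (simp add: deficiency_def)
qed

section \<open>Lowering the maximum deficiency by adding edges\<close>

lemma deficiency_antimono:
  assumes "bipartite_graph Vp Vm E'" "E \<subseteq> E'"
  shows "deficiency E' X \<le> deficiency E X"
proof -
  have "card (\<Gamma> E X) \<le> card (\<Gamma> E' X)"
    using assms bipartite_graphD(5)[OF assms(1)] by (intro card_mono) auto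
  then show ?thesis
    by (simp add: deficiency_def)
qed

lemma deficiency_insert_edge:
  assumes "bipartite_graph Vp Vm E" "u \<in> X" "w \<notin> \<Gamma> E X"
  shows "deficiency (insert (u, w) E) X = deficiency E X - 1"
proof -
  have "\<Gamma> (insert (u, w) E) X = insert w (\<Gamma> E X)"
    using assms(2) by auto
  then show ?thesis
    using assms(3) bipartite_graphD(5)[OF assms(1)] by (simp add: deficiency_def)
qed

lemma reducing_edge:
  assumes G: "bipartite_graph Vp Vm E" and less: "card Vp < card Vm"
    and pos: "max_weight (deficiency E) Vp > 0"
  obtains e where "e \<in> Vp \<times> Vm - E"
    and "max_weight (deficiency (insert e E)) Vp < max_weight (deficiency E) Vp"
proof -
  let ?p = "deficiency E"
  let ?T = "max_weight ?p"
  note fin = bipartite_graphD(1)[OF G] and sm = supermodular_deficiency[OF G]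
  obtain u where "u \<in> Vp" and u: "\<And>S. S \<subseteq> Vp \<Longrightarrow> ?T S = ?T Vp \<Longrightarrow> u \<in> S"
    using common_point_of_optimal[OF sm fin pos] by metis
  obtain M where M: "M \<subseteq> Vp" "u \<in> M" "?p M + ?T (Vp - M) = ?T Vp"
    and max: "\<And>X. X \<subseteq> Vp \<Longrightarrow> u \<in> X \<Longrightarrow> ?p X + ?T (Vp - X) = ?T Vp \<Longrightarrow> X \<subseteq> M"
    using largest_optimal_block[OF sm fin \<open>u \<in> Vp\<close> u] by metis
  \<comment> \<open>If \<open>M\<close> saw all of \<open>Vm\<close>, the size hypothesis would give
    it nonpositive deficiency; then \<open>Vp - M\<close> would still have full weight although it
    avoids \<open>u\<close>.\<close>
  have "\<Gamma> E M \<noteq> Vm"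
  proof
    assume "\<Gamma> E M = Vm"
    moreover have "card M \<le> card Vp"
      using M(1) fin by (intro card_mono)
    ultimately have "?p M \<le> 0"
      using less by (simp add: deficiency_def)
    then have "?T (Vp - M) = ?T Vp"
      using M(3) max_weight_mono[OF fin, of "Vp - M" ?p] by auto
    then show False
      using u[of "Vp - M"] M(2) by blast
  qed
  then obtain w where w: "w \<in> Vm" "w \<notin> \<Gamma> E M"
    using bipartite_graphD(4)[OF G, of M] by blast
  let ?q = "deficiency (insert (u, w) E)"
  have G': "bipartite_graph Vp Vm (insert (u, w) E)"
    using bipartite_graph_Un[OF G, of "{(u, w)}"] w(1) \<open>u \<in> Vp\<close> by simp
  have le: "?q X \<le> ?p X" for X
    using deficiency_antimono[OF G'] by auto
  \<comment> \<open>An optimal family loses weight at its block through \<open>u\<close>: that block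
    lies in \<open>M\<close>, so \<open>w\<close> is a new neighbour. Other families are already
    below the maximum and cannot gain.\<close>
  have less: "sum ?q \<X> < ?T Vp" if \<X>: "subpartition_of \<X> Vp" for \<X>
  proof (cases "sum ?p \<X> = ?T Vp")
    case True
    have sub: "\<Union>\<X> \<subseteq> Vp"
      by (rule Union_subpartition_of[OF \<X>])
    have "?T (\<Union>\<X>) = ?T Vp"
      using max_weight_ge[OF finite_subset[OF sub fin] subpartition_of_Union[OF \<X>], of ?p]
        max_weight_mono[OF fin sub, of ?p] True by simp
    then obtain X where X: "X \<in> \<X>" "u \<in> X"
      using u[OF sub] by blast
    then have "X \<subseteq> M"
      using optimal_block[OF fin \<X> True X(1)] sub by (intro max) auto
    then have "w \<notin> \<Gamma> E X"
      using w(2) by blast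
    then have "?q X < ?p X"
      using deficiency_insert_edge[OF G X(2)] by simp
    then have "sum ?q \<X> < sum ?p \<X>"
      using finite_subpartition_of[OF fin \<X>] X(1) le by (intro sum_strict_mono_ex1) auto
    then show ?thesis
      using True by simp
  next
    case False
    then show ?thesis
      using max_weight_ge[OF fin \<X>, of ?p] sum_mono[of \<X> ?q ?p, OF le] by simp
  qed
  obtain \<X> where "subpartition_of \<X> Vp" "sum ?q \<X> = max_weight ?q Vp"
    using max_weight_attained[OF fin] by metis
  then have "max_weight ?q Vp < ?T Vp"
    using less[of \<X>] by simp
  moreover have "(u, w) \<in> Vp \<times> Vm - E"
    using w M(2) \<open>u \<in> Vp\<close> by auto
  ultimately show thesis
    using that by blast
qed

text \<open>Iterate the reducing edge. Each one lowers an integer value by at least 1, so the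
  initial value bounds the number of edges.\<close>

lemma augmenting_edges_exist:
  assumes "bipartite_graph Vp Vm E" "card Vp < card Vm"
  shows "\<exists>F\<subseteq>Vp \<times> Vm - E. int (card F) \<le> max_weight (deficiency E) Vp \<and>
           max_weight (deficiency (E \<union> F)) Vp \<le> 0"
  using assms(1)
proof (induction "nat (max_weight (deficiency E) Vp)" arbitrary: E rule: less_induct)
  case less
  note fin = bipartite_graphD(1)[OF less.prems]
  show ?case
  proof (cases "max_weight (deficiency E) Vp > 0")
    case True
    then obtain e where e: "e \<in> Vp \<times> Vm - E"
      and lt: "max_weight (deficiency (insert e E)) Vp < max_weight (deficiency E) Vp"
      using reducing_edge[OF less.prems assms(2)] by metis
    have G': "bipartite_graph Vp Vm (insert e E)"
      using bipartite_graph_Un[OF less.prems, of "{e}"] e by simp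
    obtain F where F: "F \<subseteq> Vp \<times> Vm - insert e E"
      "int (card F) \<le> max_weight (deficiency (insert e E)) Vp"
      "max_weight (deficiency (insert e E \<union> F)) Vp \<le> 0"
      using less.hyps[OF _ G'] lt True by auto
    have "card (insert e F) \<le> Suc (card F)"
      by (rule card_insert_le_m1) auto
    then have "int (card (insert e F)) \<le> max_weight (deficiency E) Vp"
      using F(2) lt by linarith
    moreover have "insert e F \<subseteq> Vp \<times> Vm - E"
      using F(1) e by auto
    ultimately show ?thesis
      using F(3) by (intro exI[of _ "insert e F"]) simp
  next
    case False
    \<comment> \<open>No edge is added; the empty subpartition supplies the bound
      \<open>0 \<le> max_weight (deficiency E) Vp\<close>.\<close>
    then show ?thesis
      using max_weight_ge[OF fin subpartition_of_empty, of "deficiency E"]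
      by (intro exI[of _ "{}"]) simp
  qed
qed

section \<open>Lower bound on the number of added edges\<close>

text \<open>To reach the strict Hall inequality, each block \<open>X\<close> needs at least
  \<open>deficiency E X\<close> edges of \<open>F\<close> starting in it, and disjoint blocks share
  no such edges.\<close>

lemma sum_deficiency_le_card:
  assumes G: "bipartite_graph Vp Vm E" and F: "F \<subseteq> Vp \<times> Vm"
    and irr: "\<And>X. X \<subseteq> Vp \<Longrightarrow> X \<noteq> {} \<Longrightarrow> card X < card (\<Gamma> (E \<union> F) X)"
    and \<X>: "subpartition_of \<X> Vp"
  shows "sum (deficiency E) \<X> \<le> int (card F)"
proof -
  have finF: "finite F"
    using F bipartite_graphD(1,2)[OF G] finite_subset by blast
  have fin\<X>: "finite \<X>"
    using finite_subpartition_of[OF bipartite_graphD(1)[OF G] \<X>] .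
  \<comment> \<open>Edges are sorted by their left ends: new neighbours of different blocks may
    coincide, but left ends cannot.\<close>
  let ?F = "\<lambda>X. {e\<in>F. fst e \<in> X}"
  have "deficiency E X \<le> int (card (?F X))" if "X \<in> \<X>" for X
  proof -
    have "card X < card (\<Gamma> (E \<union> F) X)"
      using that \<X> by (intro irr) (auto simp: subpartition_of_def)
    also have "\<dots> \<le> card (\<Gamma> E X) + card (\<Gamma> F X)"
      using card_Un_le[of "\<Gamma> E X" "\<Gamma> F X"] by (simp add: Un_Image)
    also have "card (\<Gamma> F X) \<le> card (?F X)"
    proof -
      have "\<Gamma> F X \<subseteq> snd ` ?F X"
        by force
      then show ?thesis
        using finF by (intro surj_card_le) auto
    qed
    finally show ?thesis
      by (simp add: deficiency_def)
  qed
  then have "sum (deficiency E) \<X> \<le> (\<Sum>X\<in>\<X>. int (card (?F X)))"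
    by (rule sum_mono)
  also have "\<dots> = int (card (\<Union>X\<in>\<X>. ?F X))"
    using fin\<X> finF subpartition_of_disjoint[OF \<X>] by (subst card_UN_disjoint) (simp_all, blast)
  also have "\<dots> \<le> int (card F)"
    using finF by (intro of_nat_mono card_mono) auto
  finally show ?thesis .
qed

section \<open>Irreducibility when the right side is larger\<close>

text \<open>The empty set is comparable with every set, so another member of \<open>L\<close> would
  extend the chain.\<close>

lemma maxchain_singleton_bot:
  assumes "subset.maxchain L {{}}" "X \<in> L"
  shows "X = {}"
proof (rule ccontr)
  assume "X \<noteq> {}"
  then have "{{}} \<subset> {{}, X}"
    by blast
  moreover have "subset.chain L {{}, X}"
    using assms subset.maxchain_imp_chain[OF assms(1)] by (auto simp: subset.chain_def)
  ultimately show False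
    using assms(1) by (auto simp: subset.maxchain_def)
qed

text \<open>Since \<open>card Vp < card Vm\<close>, the part \<open>V\<^sub>\<infinity>\<close> is
  never empty. Irreducibility thus makes all other parts empty, which forces the chain
  \<open>[{}]\<close> and makes \<open>{}\<close> the only minimizer.\<close>

lemma dm_irreducible_iff:
  assumes G: "bipartite_graph Vp Vm E" and less: "card Vp < card Vm"
  shows "dm_irreducible Vp Vm E \<longleftrightarrow> (\<forall>X\<subseteq>Vp. X \<noteq> {} \<longrightarrow> card X < card (\<Gamma> E X))"
    (is "_ \<longleftrightarrow> ?R")
proof
  let ?L = "minimizer_lattice Vp E"
  have L: "X \<in> ?L \<longleftrightarrow> X \<subseteq> Vp \<and> (\<forall>Y\<subseteq>Vp. surplus E X \<le> surplus E Y)" for X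
    by (auto simp: minimizer_lattice_def is_arg_min_linorder)
  have empty: "surplus E {} = 0"
    by (simp add: surplus_def)
  have "Vm \<noteq> {}"
    using less by auto
  {
    assume "dm_irreducible Vp Vm E"
    then obtain Xs where chain: "dm_chain Vp E Xs"
      and ex1: "\<exists>!i. i < length (dm_parts Vp Vm E Xs) \<and> dm_parts Vp Vm E Xs ! i \<noteq> {}"
      by (auto simp: dm_irreducible_def)
    have sorted: "sorted_wrt (\<subset>) Xs" and maxc: "subset.maxchain ?L (set Xs)"
      using chain by (auto simp: dm_chain_def)
    have sub: "set Xs \<subseteq> ?L"
      using subset.maxchain_imp_chain[OF maxc] by (auto simp: subset.chain_def)
    have "?L \<noteq> {}"
    proof -
      have "finite (Pow Vp)"
        using bipartite_graphD(1)[OF G] by simp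
      then obtain X where "is_arg_min (surplus E) (\<lambda>Y. Y \<in> Pow Vp) X"
        using ex_is_arg_min_if_finite[of "Pow Vp" "surplus E"] by blast
      then have "X \<in> ?L"
        by (simp add: minimizer_lattice_def)
      then show ?thesis
        by blast
    qed
    \<comment> \<open>This secures meaningful values of \<open>hd Xs\<close> and
      \<open>last Xs\<close>; a singleton chain would properly extend the empty one.\<close>
    have "Xs \<noteq> []"
    proof
      assume "Xs = []"
      obtain X where "X \<in> ?L"
        using \<open>?L \<noteq> {}\<close> by blast
      then have "subset.chain ?L {X}"
        by (auto simp: subset.chain_def)
      then show False
        using maxc \<open>Xs = []\<close> by (auto simp: subset.maxchain_def)
    qed
    let ?P = "dm_parts Vp Vm E Xs"
    \<comment> \<open>With \<open>k = length Xs - 1\<close> there are \<open>k + 2\<close> parts, so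
      \<open>V\<^sub>\<infinity>\<close> has index \<open>length Xs\<close>.\<close>
    have len: "length ?P = Suc (length Xs)"
      using \<open>Xs \<noteq> []\<close> by (cases Xs) (auto simp: dm_parts_def simp del: upt_Suc)
    have last: "?P ! length Xs = (Vp - last Xs) \<union> (Vm - \<Gamma> E (last Xs))"
      using \<open>Xs \<noteq> []\<close> by (cases Xs) (auto simp: dm_parts_def nth_append simp del: upt_Suc)
    \<comment> \<open>If it were empty, the last minimizer would be \<open>Vp\<close> with
      neighbourhood \<open>Vm\<close>, of positive surplus, whereas \<open>{}\<close> has surplus
      0.\<close>
    have "?P ! length Xs \<noteq> {}"
    proof
      have "last Xs \<in> ?L"
        using \<open>Xs \<noteq> []\<close> sub by auto
      then have sp: "last Xs \<subseteq> Vp" "surplus E (last Xs) \<le> 0"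
        using empty unfolding L by (auto dest: spec[of _ "{}"])
      assume "?P ! length Xs = {}"
      then have "last Xs = Vp" "\<Gamma> E (last Xs) = Vm"
        using sp(1) bipartite_graphD(4)[OF G, of "last Xs"] unfolding last by blast+
      then show False
        using sp(2) less by (simp add: surplus_def)
    qed
    then have others: "?P ! i = {}" if "i < length Xs" for i
      using ex1 len that by (metis less_SucI lessI nat_neq_iff)
    \<comment> \<open>A second chain member would make \<open>V\<^sub>1\<close> nonempty, since the
      chain increases strictly.\<close>
    have "length Xs = 1"
    proof (rule ccontr)
      assume "length Xs \<noteq> 1"
      then have 1: "1 < length Xs"
        using \<open>Xs \<noteq> []\<close> by (cases Xs) auto
      then have "?P ! 1 = (Xs ! 1 - Xs ! 0) \<union> (\<Gamma> E (Xs ! 1) - \<Gamma> E (Xs ! 0))"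
        by (auto simp: dm_parts_def nth_append)
      moreover have "Xs ! 0 \<subset> Xs ! 1"
        using sorted 1 by (simp add: sorted_wrt_nth_less)
      ultimately show False
        using others[OF 1] by auto
    qed
    moreover have "hd Xs = {}"
      using others[of 0] \<open>Xs \<noteq> []\<close> by (auto simp: dm_parts_def)
    ultimately have "Xs = [{}]"
      by (cases Xs) auto
    then have "subset.maxchain ?L {{}}"
      using maxc by simp
    note only = maxchain_singleton_bot[OF this]
    have zero: "{} \<in> ?L"
      using sub \<open>Xs = [{}]\<close> by simp
    show ?R
    proof (intro allI impI)
      fix X assume X: "X \<subseteq> Vp" "X \<noteq> {}"
      have "surplus E X > 0"
      proof (rule ccontr)
        assume "\<not> surplus E X > 0"
        then have "surplus E X \<le> surplus E {}"
          using empty by simp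
        then have "X \<in> ?L"
          using zero X(1) unfolding L by (meson order_trans)
        then show False
          using only X(2) by blast
      qed
      then show "card X < card (\<Gamma> E X)"
        by (simp add: surplus_def)
    qed
  }
  {
    assume R: ?R
    have pos: "surplus E X > 0" if "X \<subseteq> Vp" "X \<noteq> {}" for X
      using R that by (simp add: surplus_def)
    have "{} \<in> ?L"
      unfolding L empty using pos by (metis empty empty_subsetI less_imp_le order_refl)
    moreover have "X = {}" if "X \<in> ?L" for X
    proof (rule ccontr)
      assume "X \<noteq> {}"
      have "X \<subseteq> Vp" "surplus E X \<le> surplus E {}"
        using that unfolding L by simp_all
      then show False
        using pos[OF _ \<open>X \<noteq> {}\<close>] empty by simp
    qed
    ultimately have "?L = {{}}"
      by blast
    then have "dm_chain Vp E [{}]"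
      by (auto simp: dm_chain_def subset.maxchain_def subset.chain_def)
    \<comment> \<open>Index 1 is \<open>V\<^sub>\<infinity>\<close>, here
      \<open>Vp \<union> Vm\<close>; index 0 is the empty part \<open>V\<^sub>0\<close>.\<close>
    moreover have "\<exists>!i. i < length (dm_parts Vp Vm E [{}]) \<and> dm_parts Vp Vm E [{}] ! i \<noteq> {}"
      using \<open>Vm \<noteq> {}\<close> by (intro ex1I[of _ 1]) (auto simp: dm_parts_def less_Suc_eq)
    ultimately show "dm_irreducible Vp Vm E"
      unfolding dm_irreducible_def by blast
  }
qed

section \<open>The min-max equality\<close>

theorem theorem1p2:
  fixes Vp Vm :: "'a set" and E :: "('a \<times> 'a) set"
  assumes "bipartite_graph Vp Vm E"
    and "card Vp < card Vm"
  shows "int (dm_opt Vp Vm E) = Max {tau E \<X> | \<X>. subpartition_of \<X> Vp}"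
proof -
  note G = assms(1) and fin = bipartite_graphD(1)[OF assms(1)]
  let ?T = "max_weight (deficiency E) Vp"
  let ?C = "{card F | F. F \<subseteq> (Vp \<times> Vm) - E \<and> dm_irreducible Vp Vm (E \<union> F)}"
  have irr: "dm_irreducible Vp Vm (E \<union> F) \<longleftrightarrow>
      (\<forall>X\<subseteq>Vp. X \<noteq> {} \<longrightarrow> card X < card (\<Gamma> (E \<union> F) X))" if "F \<subseteq> Vp \<times> Vm - E" for F
    using that by (intro dm_irreducible_iff[OF bipartite_graph_Un[OF G] assms(2)]) auto
  have lower: "?T \<le> int (card F)" if F: "F \<subseteq> Vp \<times> Vm - E" "dm_irreducible Vp Vm (E \<union> F)" for F
  proof -
    obtain \<X> where \<X>: "subpartition_of \<X> Vp" "sum (deficiency E) \<X> = ?T"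
      using max_weight_attained[OF fin] by metis
    have "sum (deficiency E) \<X> \<le> int (card F)"
      using F irr[OF F(1)] by (intro sum_deficiency_le_card[OF G _ _ \<X>(1)]) auto
    then show ?thesis
      using \<X>(2) by simp
  qed
  obtain F where F: "F \<subseteq> Vp \<times> Vm - E" "int (card F) \<le> ?T"
    and le: "max_weight (deficiency (E \<union> F)) Vp \<le> 0"
    using augmenting_edges_exist[OF assms] by blast
  \<comment> \<open>The one-block family \<open>{X}\<close> turns the bound on the maximum into the
    strict Hall inequality for \<open>X\<close>.\<close>
  have "card X < card (\<Gamma> (E \<union> F) X)" if "X \<subseteq> Vp" "X \<noteq> {}" for X
  proof -
    have "subpartition_of {X} Vp"
      using that by (auto simp: subpartition_of_def)
    from max_weight_ge[OF fin this, of "deficiency (E \<union> F)"] show ?thesis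
      using le by (simp add: deficiency_def)
  qed
  then have irrF: "dm_irreducible Vp Vm (E \<union> F)"
    using irr[OF F(1)] by blast
  have "finite (Vp \<times> Vm - E)"
    using bipartite_graphD(1,2)[OF G] by simp
  then have "finite ?C"
    by (intro finite_subset[of ?C "card ` Pow (Vp \<times> Vm - E)"]) auto
  moreover have "card F \<le> c" if "c \<in> ?C" for c
  proof -
    obtain F' where "c = card F'" "F' \<subseteq> Vp \<times> Vm - E" "dm_irreducible Vp Vm (E \<union> F')"
      using \<open>c \<in> ?C\<close> by blast
    then show ?thesis
      using lower[of F'] F(2) by simp
  qed
  ultimately have "dm_opt Vp Vm E = card F"
    unfolding dm_opt_def using F(1) irrF by (intro Min_eqI) auto
  \<comment> \<open>The constructed \<open>F\<close> has at most \<open>?T\<close> edges, and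
    \<open>lower\<close> gives at least \<open>?T\<close>.\<close>
  then have "int (dm_opt Vp Vm E) = ?T"
    using F lower[OF F(1) irrF] by simp
  then show ?thesis
    by (simp add: max_weight_def tau_eq_sum_deficiency)
qed

end
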